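(* Consider the SUM cost on an $s$–$t$ graph $G$ with $n\ge 1$ agents and $k\ge 1$ interceptors. Let $\varepsilon>0$ and let $\alpha>0$ satisfy $\alpha\ge\frac{m_c}{k\varepsilon\,\mathcal{E}_{m_c,n}}\left(n|p_{max}|-(1+\varepsilon)|p_{min}|\right)$. Then $$\min_{\sigma\in\mathcal{U}_n}F_n(\sigma,\alpha)\le(1+\varepsilon)\min_{\sigma\in(\Delta(P_{st}))^n}F_n(\sigma,\alpha).$$
   Context: Graph: $G=(V,E,s,t)$ is a finite directed acyclic multigraph ($E$ is a multiset) with source $s$ and sink $t\neq s$, such that $E\ne\emptyset$ and every edge lies on some directed $s$–$t$ path. $P_{st}$ is the set of directed $s$–$t$ paths; a path is treated as a set of edges and $|p|$ is its number of edges. $p_{max},p_{min}$ are a longest and a shortest path in $P_{st}$. $m_c=m_c(G)$ is the minimum size (number of edges) of an $s$–$t$ cut of $G$. Strategies: each of the $n$ agents picks a path, giving $a=(a_1,\dots,a_n)\in(P_{st})^n$, with $\bigcup a=\bigcup_i a_i\subseteq E$; the $k$ interceptors pick $d=(d_1,\dots,d_k)\in E^k$. $\Delta X$ is the set of probability distributions on $X$. An element $\sigma=(\sigma_1,\dots,\sigma_n)\in(\Delta(P_{st}))^n$ is identified with the product distribution on $(P_{st})^n$ (agents randomize independently). SUM cost: $C(a,d,\alpha)=\left|\bigcup a\right|+\alpha\sum_{j\le k}\mathbf 1\{d_j\in\bigcup a\}$. For a distribution $\sigma$ on $(P_{st})^n$, $F_n(\sigma,\alpha)=\max_{d\in E^k}\mathbb{E}_{a\sim\sigma}[C(a,d,\alpha)]$.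 Uniform strategies: let $MF$ be the collection of inclusion-maximal sets of pairwise edge-disjoint $s$–$t$ paths (equivalently, maximal 0–1 flows with a path decomposition). For each such set, order its paths as $p_1,\dots,p_{m'}$ with $|p_1|\le\dots\le|p_{m'}|$; its prefixes are the sets $\{p_1,\dots,p_i\}$, $1\le i\le m'$. $\mathcal{U}_n=\mathcal{U}_n(G)$ is the set of all $U_P^n$ where $P$ is a prefix of some member of $MF$, $U_P$ is the uniform distribution on $P$, and $U_P^n$ is the product of $n$ copies of $U_P$. Notation: $\mathcal{E}_{\ell,n}=\ell\left(1-\left(1-\frac1\ell\right)^n\right)$. *)

theory Defs
  imports "HOL-Probability.Probability" "Graph_Theory.Arc_Walk"
begin

text \<open>Arcs carry their own identity in \<^locale>\<open>fin_digraph\<close>, so parallel arcs are allowed.\<close>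

locale st_graph = fin_digraph G for G :: "('a, 'b) pre_digraph" +
  fixes s t :: 'a
  assumes source_in_verts: "s \<in> verts G"
    and sink_in_verts: "t \<in> verts G"
    and source_neq_sink: "s \<noteq> t"
    and acyclic: "\<not> (\<exists>p. cycle p)"
    and arcs_nonempty: "arcs G \<noteq> {}"
    and arc_on_st_path: "\<And>e. e \<in> arcs G \<Longrightarrow> \<exists>p. apath s p t \<and> e \<in> set p"

definition st_paths :: "('a, 'b) pre_digraph \<Rightarrow> 'a \<Rightarrow> 'a \<Rightarrow> 'b set set" where
  "st_paths G s t = {set p | p. pre_digraph.apath G s p t}"

definition max_path_length :: "('a, 'b) pre_digraph \<Rightarrow> 'a \<Rightarrow> 'a \<Rightarrow> nat" where
  "max_path_length G s t = Max (card ` st_paths G s t)"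

definition min_path_length :: "('a, 'b) pre_digraph \<Rightarrow> 'a \<Rightarrow> 'a \<Rightarrow> nat" where
  "min_path_length G s t = Min (card ` st_paths G s t)"

definition out_cut :: "('a, 'b) pre_digraph \<Rightarrow> 'a set \<Rightarrow> 'b set" where
  "out_cut G S = {e \<in> arcs G. tail G e \<in> S \<and> head G e \<notin> S}"

definition st_cuts :: "('a, 'b) pre_digraph \<Rightarrow> 'a \<Rightarrow> 'a \<Rightarrow> 'b set set" where
  "st_cuts G s t = {out_cut G S | S. S \<subseteq> verts G \<and> s \<in> S \<and> t \<notin> S}"

definition min_cut_size :: "('a, 'b) pre_digraph \<Rightarrow> 'a \<Rightarrow> 'a \<Rightarrow> nat" where
  "min_cut_size G s t = Min (card ` st_cuts G s t)"

text \<open>Agents are indexed by \<open>{..<n}\<close> and interceptors by \<open>{..<k}\<close>.\<close>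

definition sum_cost :: "nat \<Rightarrow> nat \<Rightarrow> (nat \<Rightarrow> 'b set) \<Rightarrow> (nat \<Rightarrow> 'b) \<Rightarrow> real \<Rightarrow> real" where
  "sum_cost n k a d \<alpha> =
     real (card (\<Union>i<n. a i)) + \<alpha> * (\<Sum>j<k. of_bool (d j \<in> (\<Union>i<n. a i)))"

definition worst_case_cost ::
  "('a, 'b) pre_digraph \<Rightarrow> nat \<Rightarrow> nat \<Rightarrow> real \<Rightarrow> (nat \<Rightarrow> 'b set) pmf \<Rightarrow> real" where
  "worst_case_cost G n k \<alpha> \<sigma> =
     Max ((\<lambda>d. measure_pmf.expectation \<sigma> (\<lambda>a. sum_cost n k a d \<alpha>)) ` ({..<k} \<rightarrow>\<^sub>E arcs G))"

text \<open>The default value \<open>{}\<close> of \<^const>\<open>Pi_pmf\<close> only concerns indices outside \<open>{..<n}\<close>,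
  which are never inspected by \<^const>\<open>sum_cost\<close>.\<close>

definition product_strategy :: "nat \<Rightarrow> (nat \<Rightarrow> 'b set pmf) \<Rightarrow> (nat \<Rightarrow> 'b set) pmf" where
  "product_strategy n \<sigma> = Pi_pmf {..<n} {} \<sigma>"

definition mixed_profiles ::
  "('a, 'b) pre_digraph \<Rightarrow> 'a \<Rightarrow> 'a \<Rightarrow> nat \<Rightarrow> (nat \<Rightarrow> 'b set) pmf set" where
  "mixed_profiles G s t n =
     {product_strategy n \<sigma> | \<sigma>. \<forall>i<n. set_pmf (\<sigma> i) \<subseteq> st_paths G s t}"

definition edge_disjoint_paths ::
  "('a, 'b) pre_digraph \<Rightarrow> 'a \<Rightarrow> 'a \<Rightarrow> 'b set set \<Rightarrow> bool" where
  "edge_disjoint_paths G s t M \<longleftrightarrow> M \<subseteq> st_paths G s t \<and> disjoint M"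

definition maximal_flows :: "('a, 'b) pre_digraph \<Rightarrow> 'a \<Rightarrow> 'a \<Rightarrow> 'b set set set" where
  "maximal_flows G s t =
     {M. edge_disjoint_paths G s t M \<and>
         (\<forall>M'. edge_disjoint_paths G s t M' \<and> M \<subseteq> M' \<longrightarrow> M' = M)}"

text \<open>An enumeration by nondecreasing length is not unique when lengths tie, so the prefixes
  depend on the choice of an enumeration \<open>ord M\<close> of every maximal family \<open>M\<close>.\<close>

definition length_ordering ::
  "('a, 'b) pre_digraph \<Rightarrow> 'a \<Rightarrow> 'a \<Rightarrow> ('b set set \<Rightarrow> 'b set list) \<Rightarrow> bool" where
  "length_ordering G s t ord \<longleftrightarrow>
     (\<forall>M \<in> maximal_flows G s t.
        set (ord M) = M \<and> distinct (ord M) \<and> sorted (map card (ord M)))"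

definition uniform_profiles ::
  "('a, 'b) pre_digraph \<Rightarrow> 'a \<Rightarrow> 'a \<Rightarrow> ('b set set \<Rightarrow> 'b set list) \<Rightarrow> nat
     \<Rightarrow> (nat \<Rightarrow> 'b set) pmf set" where
  "uniform_profiles G s t ord n =
     {product_strategy n (\<lambda>_. pmf_of_set (set (take i (ord M)))) | M i.
        M \<in> maximal_flows G s t \<and> 1 \<le> i \<and> i \<le> length (ord M)}"

text \<open>For \<open>l \<ge> 1\<close> this is the expected number of distinct values among \<open>n\<close> independent
  uniform draws from \<open>l\<close> values.\<close>

definition expected_distinct :: "nat \<Rightarrow> nat \<Rightarrow> real" where
  "expected_distinct l n = real l * (1 - (1 - 1 / real l) ^ n)"

end

theory Submission
  imports Defs
begin

text \<open>Let \<open>m\<close> be the minimum cut size and \<open>q = 1 - (1 - 1/m)^n\<close>. By Menger's theorem there are \<open>m\<close>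
  edge-disjoint paths; if all agents draw uniformly from them, every arc is hit with probability at
  most \<open>q\<close>, so the cost is at most \<open>n |p_max| + \<alpha> k q\<close>. Conversely every agent crosses a minimum
  cut, so by AM-GM some cut arc is hit with probability at least \<open>q\<close> under any independent
  randomization, and the cost is at least \<open>|p_min| + \<alpha> k q\<close>. The assumption on \<open>\<alpha>\<close> says exactly that the
  first bound is at most \<open>1 + \<epsilon>\<close> times the second.\<close>

section \<open>Unit-capacity flows\<close>

text \<open>A 0-1 flow is encoded as the set of arcs that carry it; the balance is outflow minus
  inflow.\<close>

definition net_flow :: "('a, 'b) pre_digraph \<Rightarrow> 'b set \<Rightarrow> 'a \<Rightarrow> int" where
  "net_flow G F v = (\<Sum>e\<in>F. of_bool (tail G e = v) - of_bool (head G e = v))"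

text \<open>One equation states both conservation at inner vertices and the value \<open>m\<close>
  at the two terminals.\<close>

definition is_unit_flow :: "('a, 'b) pre_digraph \<Rightarrow> 'a \<Rightarrow> 'a \<Rightarrow> int \<Rightarrow> 'b set \<Rightarrow> bool" where
  "is_unit_flow G s t m F \<longleftrightarrow> F \<subseteq> arcs G \<and>
     (\<forall>v. net_flow G F v = m * (of_bool (v = s) - of_bool (v = t)))"

definition residual :: "('a, 'b) pre_digraph \<Rightarrow> 'b set \<Rightarrow> 'a \<Rightarrow> 'a \<Rightarrow> bool" where
  "residual G F u v \<longleftrightarrow>
     (\<exists>e\<in>arcs G. (e \<notin> F \<and> tail G e = u \<and> head G e = v) \<or> (e \<in> F \<and> tail G e = v \<and> head G e = u))"

section \<open>Net flow of vertex sets and paths\<close>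

context fin_digraph
begin

text \<open>Exchange the sums: an arc counts +1 at its tail and -1 at its head, so arcs inside
  \<open>S\<close> cancel.\<close>

lemma sum_net_flow:
  assumes "F \<subseteq> arcs G" "finite S"
  shows "(\<Sum>v\<in>S. net_flow G F v) = (\<Sum>e\<in>F. of_bool (tail G e \<in> S) - of_bool (head G e \<in> S))"
proof -
  have "finite F"
    using assms finite_arcs finite_subset by blast
  have *: "(\<Sum>v\<in>S. of_bool (x = v)) = (of_bool (x \<in> S) :: int)" for x
    using assms(2) by (simp add: of_bool_def)
  show ?thesis
    unfolding net_flow_def
    by (subst sum.swap) (simp add: sum_subtractf *)
qed

text \<open>The sum telescopes, since the head of each arc is the tail of the next.\<close>

lemma sum_cut_walk:
  assumes "cas u p v"
  shows "(\<Sum>e\<leftarrow>p. of_bool (tail G e \<in> S) - of_bool (head G e \<in> S))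
    = (of_bool (u \<in> S) - of_bool (v \<in> S) :: int)"
  using assms by (induction p arbitrary: u) auto

text \<open>A path repeats no vertex, hence no arc, so the list sum becomes a sum over the arc
  set.\<close>

lemma sum_cut_apath:
  assumes "apath u p v"
  shows "(\<Sum>e\<in>set p. of_bool (tail G e \<in> S) - of_bool (head G e \<in> S))
    = (of_bool (u \<in> S) - of_bool (v \<in> S) :: int)"
proof -
  have "distinct p" "cas u p v"
    using assms distinct_verts_imp_distinct by (auto simp: apath_def awalk_def)
  then show ?thesis
    using sum_cut_walk[of u p v S] by (simp add: sum_list_distinct_conv_sum_set)
qed

lemma net_flow_apath:
  assumes "apath u p v"
  shows "net_flow G (set p) w = of_bool (u = w) - of_bool (v = w)"
  using sum_cut_apath[OF assms, of "{w}"] by (simp add: net_flow_def)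

text \<open>The telescoped sum is 1, so some term is positive, and such a term is an arc leaving
  \<open>S\<close>.\<close>

lemma apath_crosses_cut:
  assumes "apath u p v" "u \<in> S" "v \<notin> S"
  obtains e where "e \<in> set p" "e \<in> out_cut G S"
proof -
  have "(\<Sum>e\<in>set p. of_bool (tail G e \<in> S) - of_bool (head G e \<in> S)) = (1 :: int)"
    using sum_cut_apath[OF assms(1), of S] assms by simp
  then have "\<exists>e\<in>set p. tail G e \<in> S \<and> head G e \<notin> S"
    by (smt (verit) of_bool_eq sum_nonpos)
  moreover have "set p \<subseteq> arcs G"
    using assms(1) by (auto simp: apath_def awalk_def)
  ultimately show thesis
    using that by (auto simp: out_cut_def)
qed

text \<open>Walks are listed from their end back to their start. Confining the change to arcs
  inside the walk keeps the residual arcs of the remaining walk intact, so that the walk can be augmented one arc at a time.\<close>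

lemma augment_residual_walk:
  assumes "F \<subseteq> arcs G" "ws \<noteq> []" "successively (\<lambda>v u. residual G F u v) ws" "distinct ws"
  shows "\<exists>F'\<subseteq>arcs G.
    (\<forall>v. net_flow G F' v = net_flow G F v + of_bool (v = last ws) - of_bool (v = hd ws)) \<and>
    (\<forall>e. tail G e \<notin> set ws \<or> head G e \<notin> set ws \<longrightarrow> (e \<in> F' \<longleftrightarrow> e \<in> F))"
  using assms(2-)
proof (induction ws rule: list_nonempty_induct)
  case (single x)
  then show ?case
    using assms(1) by auto
next
  case (cons w ws)
  define u where "u = hd ws"
  have "u \<in> set ws" "w \<notin> set ws"
    using cons by (auto simp: u_def)
  have "residual G F u w" and succ: "successively (\<lambda>v u. residual G F u v) ws"
    using cons by (auto simp: u_def successively_Cons)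
  then obtain e where e: "e \<in> arcs G"
    "(e \<notin> F \<and> tail G e = u \<and> head G e = w) \<or> (e \<in> F \<and> tail G e = w \<and> head G e = u)"
    by (auto simp: residual_def)
  obtain F' where F': "F' \<subseteq> arcs G"
    "\<And>v. net_flow G F' v = net_flow G F v + of_bool (v = last ws) - of_bool (v = u)"
    "\<And>e. tail G e \<notin> set ws \<or> head G e \<notin> set ws \<Longrightarrow> e \<in> F' \<longleftrightarrow> e \<in> F"
    using cons.IH succ cons.prems unfolding u_def by fastforce
  have "finite F'"
    using F'(1) finite_arcs finite_subset by blast
  \<comment> \<open>The arc \<open>e\<close> has the endpoint \<open>w\<close> outside
    \<open>ws\<close>, so augmenting along \<open>ws\<close> has not touched it.\<close>
  have same: "e \<in> F' \<longleftrightarrow> e \<in> F"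
    using F'(3) e \<open>w \<notin> set ws\<close> by auto
  \<comment> \<open>Cancel \<open>e\<close> if it is used, otherwise add it: either way one unit
    moves from \<open>w\<close> to \<open>u\<close> in the balance.\<close>
  define F'' where "F'' = (if e \<in> F then F' - {e} else insert e F')"
  have "net_flow G F'' v = net_flow G F v + of_bool (v = last ws) - of_bool (v = w)" for v
  proof (cases "e \<in> F")
    case True
    then have "net_flow G F'' v = net_flow G F' v - (of_bool (w = v) - of_bool (u = v))"
      using same e \<open>finite F'\<close> by (auto simp: F''_def net_flow_def sum_diff1)
    then show ?thesis
      using F'(2)[of v] by (auto simp: of_bool_def)
  next
    case False
    then have "net_flow G F'' v = net_flow G F' v + (of_bool (u = v) - of_bool (w = v))"
      using same e \<open>finite F'\<close> by (auto simp: F''_def net_flow_def)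
    then show ?thesis
      using F'(2)[of v] by (auto simp: of_bool_def)
  qed
  moreover have "F'' \<subseteq> arcs G"
    using F'(1) e by (auto simp: F''_def)
  moreover have "e' \<in> F'' \<longleftrightarrow> e' \<in> F" if "tail G e' \<notin> set (w # ws) \<or> head G e' \<notin> set (w # ws)" for e'
    using that e \<open>u \<in> set ws\<close> F'(3)[of e'] by (auto simp: F''_def)
  ultimately show ?case
    using cons.hyps by (intro exI[of _ F'']) auto
qed

lemma ex_flow_eq_cut:
  assumes "s \<in> verts G" "t \<in> verts G" "s \<noteq> t"
  shows "\<exists>m F S. is_unit_flow G s t (int m) F \<and> S \<subseteq> verts G \<and> s \<in> S \<and> t \<notin> S \<and> m = card (out_cut G S)"
proof -
  define vals where "vals = {m. \<exists>F. is_unit_flow G s t m F}"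
  \<comment> \<open>Since \<open>s\<close> and \<open>t\<close> differ, the value of a flow is its
    net flow at \<open>s\<close>; finitely many arc sets thus give finitely many values.\<close>
  have "vals \<subseteq> (\<lambda>F. net_flow G F s) ` Pow (arcs G)"
  proof
    fix m assume "m \<in> vals"
    then obtain F where "F \<subseteq> arcs G" "net_flow G F s = m"
      using \<open>s \<noteq> t\<close> by (auto simp: vals_def is_unit_flow_def)
    then show "m \<in> (\<lambda>F. net_flow G F s) ` Pow (arcs G)"
      by blast
  qed
  then have "finite vals"
    by (rule finite_subset) simp
  have "is_unit_flow G s t 0 {}"
    by (auto simp: is_unit_flow_def net_flow_def)
  then have "vals \<noteq> {}"
    by (auto simp: vals_def)
  define m where "m = Max vals"
  have "m \<in> vals"
    using Max_in \<open>finite vals\<close> \<open>vals \<noteq> {}\<close> by (auto simp: m_def)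
  then obtain F where F: "is_unit_flow G s t m F"
    by (auto simp: vals_def)
  then have "F \<subseteq> arcs G" and net: "\<And>v. net_flow G F v = m * (of_bool (v = s) - of_bool (v = t))"
    by (auto simp: is_unit_flow_def)
  have "finite F"
    using \<open>F \<subseteq> arcs G\<close> finite_arcs finite_subset by blast
  \<comment> \<open>Reachability uses vertex-distinct walks listed backwards, as
    \<open>augment_residual_walk\<close> requires.\<close>
  define S where "S = {hd ws | ws. ws \<noteq> [] \<and> last ws = s \<and> distinct ws \<and> set ws \<subseteq> verts G \<and>
    successively (\<lambda>v u. residual G F u v) ws}"
  have "s \<in> S"
    unfolding S_def using assms by (intro CollectI exI[of _ "[s]"]) auto
  have "S \<subseteq> verts G"
    by (auto simp: S_def)
  then have "finite S"
    using finite_verts finite_subset by blast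
  have "t \<notin> S"
  proof
    assume "t \<in> S"
    then obtain ws where ws: "ws \<noteq> []" "last ws = s" "distinct ws" "hd ws = t"
      "successively (\<lambda>v u. residual G F u v) ws"
      by (auto simp: S_def)
    then obtain F' where "F' \<subseteq> arcs G"
      "\<And>v. net_flow G F' v = net_flow G F v + of_bool (v = s) - of_bool (v = t)"
      using augment_residual_walk[OF \<open>F \<subseteq> arcs G\<close>, of ws] by metis
    then have "is_unit_flow G s t (m + 1) F'"
      by (auto simp: is_unit_flow_def net algebra_simps)
    then have "m + 1 \<le> m"
      using \<open>finite vals\<close> unfolding m_def by (intro Max_ge) (auto simp: vals_def m_def)
    then show False
      by simp
  qed
  have closed: "w \<in> S" if "u \<in> S" "residual G F u w" for u w
  proof -
    obtain ws where ws: "ws \<noteq> []" "last ws = s" "distinct ws" "set ws \<subseteq> verts G" "hd ws = u"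
      "successively (\<lambda>v u. residual G F u v) ws"
      using \<open>u \<in> S\<close> by (auto simp: S_def)
    have "w \<in> verts G"
      using that by (auto simp: residual_def)
    show ?thesis
    proof (cases "w \<in> set ws")
      \<comment> \<open>If \<open>w\<close> was visited before, cutting the walk back to
        \<open>w\<close> keeps it distinct.\<close>
      case True
      then obtain xs ys where "ws = xs @ w # ys"
        by (meson split_list)
      then show ?thesis
        unfolding S_def using ws
        by (intro CollectI exI[of _ "w # ys"]) (auto simp: successively_append_iff)
    next
      case False
      then show ?thesis
        unfolding S_def using ws that \<open>w \<in> verts G\<close>
        by (intro CollectI exI[of _ "w # ws"]) (auto simp: successively_Cons)
    qed
  qed
  have out: "out_cut G S \<subseteq> F"
    using closed by (fastforce simp: out_cut_def residual_def)
  have "m = (\<Sum>v\<in>S. net_flow G F v)"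
    using \<open>finite S\<close> \<open>s \<in> S\<close> \<open>t \<notin> S\<close> by (simp add: net sum_subtractf sum_distrib_left[symmetric] of_bool_def)
  also have "\<dots> = (\<Sum>e\<in>F. of_bool (tail G e \<in> S) - of_bool (head G e \<in> S))"
    using sum_net_flow \<open>F \<subseteq> arcs G\<close> \<open>finite S\<close> by blast
  \<comment> \<open>A used arc entering \<open>S\<close> would be a reversed residual arc and pull
    its tail into \<open>S\<close>, so only leaving arcs contribute.\<close>
  also have "\<dots> = (\<Sum>e\<in>F. of_bool (e \<in> out_cut G S))"
  proof (rule sum.cong)
    fix e assume "e \<in> F"
    then have "tail G e \<in> S" if "head G e \<in> S"
      using closed[OF that] \<open>F \<subseteq> arcs G\<close> by (auto simp: residual_def)
    then show "of_bool (tail G e \<in> S) - of_bool (head G e \<in> S) = (of_bool (e \<in> out_cut G S) :: int)"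
      using \<open>e \<in> F\<close> \<open>F \<subseteq> arcs G\<close> by (auto simp: out_cut_def)
  qed simp
  also have "\<dots> = int (card (out_cut G S))"
    using out \<open>finite F\<close> by (simp add: Int_absorb1)
  finally show ?thesis
    using F \<open>S \<subseteq> verts G\<close> \<open>s \<in> S\<close> \<open>t \<notin> S\<close> by blast
qed

section \<open>Decomposition of a flow into edge-disjoint paths\<close>

lemma flow_contains_apath:
  assumes "is_unit_flow G s t m F" "m > 0" "s \<in> verts G" "s \<noteq> t"
  obtains p where "apath s p t" "set p \<subseteq> F"
proof -
  have F: "F \<subseteq> arcs G" and net: "\<And>v. net_flow G F v = m * (of_bool (v = s) - of_bool (v = t))"
    using assms by (auto simp: is_unit_flow_def)
  \<comment> \<open>If the set reachable from \<open>s\<close> inside \<open>F\<close> missed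
    \<open>t\<close>, its net flow would be \<open>m > 0\<close>, although no arc of
    \<open>F\<close> leaves it.\<close>
  define S where "S = {v. \<exists>p. awalk s p v \<and> set p \<subseteq> F}"
  have "S \<subseteq> verts G"
    by (auto simp: S_def)
  then have "finite S"
    using finite_verts finite_subset by blast
  have "s \<in> S"
    using assms by (auto simp: S_def awalk_Nil_iff intro!: exI[of _ "[]"])
  have closed: "head G e \<in> S" if "e \<in> F" "tail G e \<in> S" for e
  proof -
    obtain p where "awalk s p (tail G e)" "set p \<subseteq> F"
      using \<open>tail G e \<in> S\<close> by (auto simp: S_def)
    moreover have "awalk (tail G e) [e] (head G e)"
      using that F arc_implies_awalk by blast
    ultimately show ?thesis
      unfolding S_def using \<open>e \<in> F\<close> by (intro CollectI exI[of _ "p @ [e]"]) auto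
  qed
  have "t \<in> S"
  proof (rule ccontr)
    assume "t \<notin> S"
    then have "m = (\<Sum>v\<in>S. net_flow G F v)"
      using \<open>finite S\<close> \<open>s \<in> S\<close> by (simp add: net sum_subtractf sum_distrib_left[symmetric] of_bool_def)
    also have "\<dots> = (\<Sum>e\<in>F. of_bool (tail G e \<in> S) - of_bool (head G e \<in> S))"
      using sum_net_flow F \<open>finite S\<close> by blast
    also have "\<dots> \<le> 0"
      using closed by (intro sum_nonpos) auto
    finally show False
      using \<open>m > 0\<close> by simp
  qed
  then obtain p where "awalk s p t" "set p \<subseteq> F"
    by (auto simp: S_def)
  then show thesis
    using that apath_awalk_to_apath awalk_to_apath_subset by blast
qed

lemma apath_arcs_nonempty:
  assumes "apath s p t" "s \<noteq> t"
  shows "set p \<noteq> {}"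
  using assms by (auto simp: apath_Nil_iff)

text \<open>Peel off one path at a time: removing an \<open>s\<close>-\<open>t\<close> path lowers
  the value by one and leaves a flow.\<close>

lemma flow_decomposition:
  assumes "is_unit_flow G s t (int m) F" "s \<in> verts G" "s \<noteq> t"
  shows "\<exists>M. edge_disjoint_paths G s t M \<and> finite M \<and> \<Union>M \<subseteq> F \<and> card M = m"
  using assms(1)
proof (induction m arbitrary: F)
  case 0
  show ?case
    by (intro exI[of _ "{}"]) (auto simp: edge_disjoint_paths_def disjoint_def)
next
  case (Suc m)
  then obtain p where p: "apath s p t" "set p \<subseteq> F"
    using assms by (auto elim: flow_contains_apath)
  have F: "F \<subseteq> arcs G"
    and net: "\<And>v. net_flow G F v = int (Suc m) * (of_bool (v = s) - of_bool (v = t))"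
    using Suc.prems by (auto simp: is_unit_flow_def)
  then have "finite F"
    using finite_arcs finite_subset by blast
  have "net_flow G (F - set p) v = net_flow G F v - net_flow G (set p) v" for v
    unfolding net_flow_def using \<open>finite F\<close> p by (intro sum_diff) auto
  then have "is_unit_flow G s t (int m) (F - set p)"
    using F by (auto simp: is_unit_flow_def net net_flow_apath[OF p(1)] of_bool_def)
  then obtain M where M: "edge_disjoint_paths G s t M" "finite M" "\<Union>M \<subseteq> F - set p" "card M = m"
    using Suc.IH by blast
  \<comment> \<open>A member of \<open>M\<close> avoids \<open>set p\<close>, so
    \<open>set p\<close> itself could be a member only if it were empty. Hence the cardinality
    really grows.\<close>
  have "set p \<notin> M"
    using M(3) apath_arcs_nonempty[OF p(1) \<open>s \<noteq> t\<close>] by (metis Diff_disjoint Sup_upper inf.orderE order_trans inf_commute)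
  moreover have "edge_disjoint_paths G s t (insert (set p) M)"
    using M(1,3) p(1) by (auto simp: edge_disjoint_paths_def st_paths_def disjoint_def)
  ultimately show ?case
    using M p by (intro exI[of _ "insert (set p) M"]) auto
qed

end

section \<open>Hitting probabilities\<close>

lemma finite_bounded_index_family:
  "finite {f M i | M i. M \<in> F \<and> 1 \<le> i \<and> i \<le> length (ord M)}" if "finite F"
proof -
  have "{f M i | M i. M \<in> F \<and> 1 \<le> i \<and> i \<le> length (ord M)}
      = (\<lambda>(M, i). f M i) ` (SIGMA M:F. {1..length (ord M)})"
    by force
  then show ?thesis
    using that by simp
qed

text \<open>By independence the avoidance probabilities multiply;
  \<open>prob_product_strategy_hit\<close> identifies this with the actual probability.\<close>

definition hit_prob :: "nat \<Rightarrow> (nat \<Rightarrow> 'b set pmf) \<Rightarrow> 'b \<Rightarrow> real" where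
  "hit_prob n \<sigma> e = 1 - (\<Prod>i<n. 1 - measure_pmf.prob (\<sigma> i) {p. e \<in> p})"

lemma prob_product_strategy_hit:
  "measure_pmf.prob (product_strategy n \<sigma>) {a. e \<in> (\<Union>i<n. a i)} = hit_prob n \<sigma> e"
proof -
  have compl: "measure_pmf.prob \<mu> {x. \<not> Q x} = 1 - measure_pmf.prob \<mu> {x. Q x}"
    for \<mu> :: "'c pmf" and Q
    using measure_pmf.prob_compl[of "{x. Q x}" \<mu>] by (simp add: Compl_eq_Diff_UNIV[symmetric] Collect_neg_eq)
  have "{a. e \<notin> (\<Union>i<n. a i)} = Pi {..<n} (\<lambda>_. {p. e \<notin> p})"
    by auto
  then have "measure_pmf.prob (product_strategy n \<sigma>) {a. e \<notin> (\<Union>i<n. a i)}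
      = (\<Prod>i<n. measure_pmf.prob (\<sigma> i) {p. e \<notin> p})"
    by (simp add: product_strategy_def measure_Pi_pmf_Pi)
  also have "\<dots> = (\<Prod>i<n. 1 - measure_pmf.prob (\<sigma> i) {p. e \<in> p})"
    by (simp only: compl)
  finally show ?thesis
    by (subst (asm) compl) (simp add: hit_prob_def)
qed

lemma set_product_strategy:
  assumes "\<forall>i<n. set_pmf (\<sigma> i) \<subseteq> P" "a \<in> set_pmf (product_strategy n \<sigma>)" "i < n"
  shows "a i \<in> P"
  using assms by (auto simp: product_strategy_def set_Pi_pmf PiE_dflt_def)

lemma finite_set_product_strategy:
  assumes "\<forall>i<n. set_pmf (\<sigma> i) \<subseteq> P" "finite P"
  shows "finite (set_pmf (product_strategy n \<sigma>))"
proof -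
  have "finite (set_pmf (\<sigma> i))" if "i < n" for i
    using assms that by (meson finite_subset)
  then show ?thesis
    by (auto simp: product_strategy_def set_Pi_pmf)
qed

text \<open>Linearity of expectation separates the cost: the interceptors influence only the sum of
  hitting probabilities.\<close>

lemma expectation_sum_cost:
  assumes "\<forall>i<n. set_pmf (\<sigma> i) \<subseteq> P" "finite P"
  shows "measure_pmf.expectation (product_strategy n \<sigma>) (\<lambda>a. sum_cost n k a d \<alpha>)
    = measure_pmf.expectation (product_strategy n \<sigma>) (\<lambda>a. real (card (\<Union>i<n. a i)))
      + \<alpha> * (\<Sum>j<k. hit_prob n \<sigma> (d j))"
proof -
  have integrable: "integrable (product_strategy n \<sigma>) f" for f :: "_ \<Rightarrow> real"
    using finite_set_product_strategy[OF assms] by (rule integrable_measure_pmf_finite)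
  have hit: "measure_pmf.expectation (product_strategy n \<sigma>) (\<lambda>a. of_bool (e \<in> (\<Union>i<n. a i)))
      = hit_prob n \<sigma> e" for e
  proof -
    have "(\<lambda>a. of_bool (e \<in> (\<Union>i<n. a i)) :: real) = indicator {a. e \<in> (\<Union>i<n. a i)}"
      by (auto simp: indicator_def)
    then show ?thesis
      using prob_product_strategy_hit[of n \<sigma> e] by simp
  qed
  show ?thesis
    unfolding sum_cost_def
    by (simp only: Bochner_Integration.integral_add[OF integrable integrable]
        Bochner_Integration.integral_sum[OF integrable] integral_mult_right_zero hit)
qed

text \<open>Write the cardinality as a sum of indicators over arcs. This makes the expected cost a
  polynomial in the path weights, from which continuity follows.\<close>

lemma expectation_card_union:
  assumes "\<forall>i<n. set_pmf (\<sigma> i) \<subseteq> P" "P \<subseteq> Pow A" "finite A"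
  shows "measure_pmf.expectation (product_strategy n \<sigma>) (\<lambda>a. real (card (\<Union>i<n. a i)))
    = (\<Sum>e\<in>A. hit_prob n \<sigma> e)"
proof -
  have "finite P"
    using assms finite_subset by blast
  have integrable: "integrable (product_strategy n \<sigma>) f" for f :: "_ \<Rightarrow> real"
    using finite_set_product_strategy[OF assms(1) \<open>finite P\<close>] by (rule integrable_measure_pmf_finite)
  have "measure_pmf.expectation (product_strategy n \<sigma>) (\<lambda>a. real (card (\<Union>i<n. a i)))
      = measure_pmf.expectation (product_strategy n \<sigma>)
          (\<lambda>a. \<Sum>e\<in>A. indicator {a. e \<in> (\<Union>i<n. a i)} a)"
  proof (rule integral_cong_AE)
    show "AE a in product_strategy n \<sigma>. real (card (\<Union>i<n. a i))
        = (\<Sum>e\<in>A. indicator {a. e \<in> (\<Union>i<n. a i)} a)"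
    proof (rule AE_pmfI)
      fix a assume "a \<in> set_pmf (product_strategy n \<sigma>)"
      then have "(\<Union>i<n. a i) \<subseteq> A"
        using set_product_strategy[OF assms(1)] assms(2) by blast
      then have "A \<inter> {e. e \<in> (\<Union>i<n. a i)} = (\<Union>i<n. a i)"
        by auto
      then show "real (card (\<Union>i<n. a i)) = (\<Sum>e\<in>A. indicator {a. e \<in> (\<Union>i<n. a i)} a)"
        using \<open>finite A\<close> by (simp add: indicator_def del: UN_iff)
    qed
  qed auto
  also have "\<dots> = (\<Sum>e\<in>A. measure_pmf.prob (product_strategy n \<sigma>) {a. e \<in> (\<Union>i<n. a i)})"
    using integrable by (simp add: Bochner_Integration.integral_sum del: UN_iff)
  finally show ?thesis
    by (simp only: prob_product_strategy_hit)
qed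

text \<open>If all agents avoid every element of \<open>C\<close> too often, AM-GM makes the total visiting
  probability of some agent on \<open>C\<close> smaller than one.\<close>

lemma ex_prod_avoid_le:
  fixes x :: "nat \<Rightarrow> 'c \<Rightarrow> real"
  assumes "finite C" "C \<noteq> {}" "n \<ge> 1"
    and le1: "\<And>i e. i < n \<Longrightarrow> e \<in> C \<Longrightarrow> x i e \<le> 1"
    and cover: "\<And>i. i < n \<Longrightarrow> (\<Sum>e\<in>C. x i e) \<ge> 1"
  shows "\<exists>e\<in>C. (\<Prod>i<n. 1 - x i e) \<le> (1 - 1 / real (card C)) ^ n"
proof (rule ccontr)
  assume "\<not> ?thesis"
  then have gt: "(1 - 1 / real (card C)) ^ n < (\<Prod>i<n. 1 - x i e)" if "e \<in> C" for e
    using that by (auto simp: not_le)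
  define c where "c = 1 - 1 / real (card C)"
  have "card C \<ge> 1"
    using assms(1,2) by (simp add: Suc_leI card_gt_0_iff)
  then have "c \<ge> 0"
    by (simp add: c_def)
  have "real n * c < (\<Sum>i<n. 1 - x i e)" if "e \<in> C" for e
  proof -
    \<comment> \<open>Take \<open>n\<close>-th roots; \<open>c = 0\<close> is separate because
      \<open>powr_realpow\<close> needs a positive base.\<close>
    have "c = (c ^ n) powr (1 / n)"
      using \<open>c \<ge> 0\<close> \<open>n \<ge> 1\<close>
      by (cases "c = 0") (auto simp: powr_realpow[symmetric] powr_powr)
    also have "\<dots> < (\<Prod>i<n. 1 - x i e) powr (1 / n)"
      using gt[OF that] \<open>c \<ge> 0\<close> \<open>n \<ge> 1\<close> by (intro powr_less_mono2) (auto simp: c_def)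
    also have "\<dots> \<le> (\<Sum>i<n. (1 - x i e) / n)"
      using arith_geom_mean[of "{..<n}" "\<lambda>i. 1 - x i e"] le1 that \<open>n \<ge> 1\<close> by (auto simp: lessThan_empty_iff)
    finally show ?thesis
      using \<open>n \<ge> 1\<close> by (simp add: sum_divide_distrib[symmetric] field_simps)
  qed
  \<comment> \<open>Count the total avoidance over \<open>C\<close> in two ways: it exceeds
    \<open>n * c * card C = n * (card C - 1)\<close>, yet each agent contributes at most
    \<open>card C - 1\<close>.\<close>
  then have "(\<Sum>e\<in>C. real n * c) < (\<Sum>e\<in>C. \<Sum>i<n. 1 - x i e)"
    using assms(1,2) by (intro sum_strict_mono) auto
  also have "\<dots> = (\<Sum>i<n. real (card C) - (\<Sum>e\<in>C. x i e))"
    by (subst sum.swap) (simp add: sum_subtractf)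
  also have "\<dots> \<le> (\<Sum>i<n. real (card C) - 1)"
    using cover by (intro sum_mono) auto
  also have "\<dots> = (\<Sum>e\<in>C. real n * c)"
    using \<open>card C \<ge> 1\<close> by (simp add: c_def field_simps)
  finally show False
    by simp
qed

text \<open>Every path meets \<open>C\<close>, so by the union bound each agent's visiting
  probabilities on \<open>C\<close> sum to at least one, and \<open>ex_prod_avoid_le\<close>
  applies.\<close>

lemma ex_hit_prob_ge:
  assumes "finite C" "C \<noteq> {}" "n \<ge> 1"
    and "\<forall>i<n. set_pmf (\<sigma> i) \<subseteq> P" "\<And>p. p \<in> P \<Longrightarrow> p \<inter> C \<noteq> {}"
  shows "\<exists>e\<in>C. hit_prob n \<sigma> e \<ge> 1 - (1 - 1 / real (card C)) ^ n"
proof -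
  have "(\<Sum>e\<in>C. measure_pmf.prob (\<sigma> i) {p. e \<in> p}) \<ge> 1" if "i < n" for i
  proof -
    have "1 = measure_pmf.prob (\<sigma> i) (\<Union>e\<in>C. {p. e \<in> p})"
      using assms(4,5) that
      by (intro measure_pmf.prob_eq_1[THEN iffD2, symmetric] AE_pmfI) (auto, blast)
    also have "\<dots> \<le> (\<Sum>e\<in>C. measure_pmf.prob (\<sigma> i) {p. e \<in> p})"
      using assms(1) by (intro measure_pmf.finite_measure_subadditive_finite) auto
    finally show ?thesis .
  qed
  then show ?thesis
    using ex_prod_avoid_le[of C n "\<lambda>i e. measure_pmf.prob (\<sigma> i) {p. e \<in> p}"] assms(1-3)
    by (auto simp: hit_prob_def algebra_simps)
qed

text \<open>Disjointness puts \<open>e\<close> on at most one path of \<open>M\<close>, so a single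
  draw hits it with probability at most \<open>1 / card M\<close>.\<close>

lemma hit_prob_uniform_le:
  assumes "finite M" "M \<noteq> {}" "disjoint M"
  shows "hit_prob n (\<lambda>_. pmf_of_set M) e \<le> 1 - (1 - 1 / real (card M)) ^ n"
proof -
  have "card (M \<inter> {p. e \<in> p}) \<le> 1"
  proof (rule ccontr)
    assume "\<not> ?thesis"
    then obtain p q where "p \<in> M" "q \<in> M" "e \<in> p" "e \<in> q" "p \<noteq> q"
      using assms(1) by (auto simp: not_le card_le_Suc0_iff_eq)
    then show False
      using assms(3) by (auto simp: disjoint_def)
  qed
  moreover have "card M \<ge> 1"
    using assms by (simp add: Suc_leI card_gt_0_iff)
  ultimately have "measure_pmf.prob (pmf_of_set M) {p. e \<in> p} \<le> 1 / real (card M)"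
    using assms by (simp add: measure_pmf_of_set divide_right_mono)
  then have "(1 - 1 / real (card M)) ^ n \<le> (1 - measure_pmf.prob (pmf_of_set M) {p. e \<in> p}) ^ n"
    using \<open>card M \<ge> 1\<close> by (intro power_mono) auto
  then show ?thesis
    by (simp add: hit_prob_def)
qed

section \<open>Existence of an optimal mixed profile\<close>

lemma continuous_on_Max:
  fixes f :: "'i \<Rightarrow> 'c :: topological_space \<Rightarrow> real"
  assumes "finite I" "I \<noteq> {}" "\<And>i. i \<in> I \<Longrightarrow> continuous_on S (f i)"
  shows "continuous_on S (\<lambda>x. Max ((\<lambda>i. f i x) ` I))"
  using assms by (induction I rule: finite_ne_induct) (auto intro!: continuous_on_max)

text \<open>Used to read a minimizing weight vector back as a strategy.\<close>

lemma pmf_with_weights: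
  fixes w :: "'c \<Rightarrow> real"
  assumes "finite P" "\<And>p. w p \<ge> 0" "\<And>p. p \<notin> P \<Longrightarrow> w p = 0" "(\<Sum>p\<in>P. w p) = 1"
  shows "\<exists>\<mu>. set_pmf \<mu> \<subseteq> P \<and> (\<forall>p. pmf \<mu> p = w p)"
proof -
  have "(\<integral>\<^sup>+ p. ennreal (w p) \<partial>count_space UNIV) = (\<Sum>p\<in>P. ennreal (w p))"
    using assms(1,3) by (intro nn_integral_count_space') auto
  also have "\<dots> = 1"
    using assms(2,4) by (simp add: sum_ennreal)
  finally have "pmf (embed_pmf w) p = w p" for p
    using assms(2) by (intro pmf_embed_pmf)
  then show ?thesis
    using assms(3) by (intro exI[of _ "embed_pmf w"]) (auto simp: set_pmf_eq)
qed

text \<open>The minimum is attained because the cost is continuous in the weights, which range over a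
  compact product of simplices.\<close>

lemma ex_arg_min_mixed:
  fixes G :: "('a, 'b) pre_digraph"
  assumes P: "st_paths G s t \<noteq> {}" "st_paths G s t \<subseteq> Pow (arcs G)" and "finite (arcs G)" "arcs G \<noteq> {}"
  shows "\<exists>\<tau>. is_arg_min (worst_case_cost G n k \<alpha>) (\<lambda>\<tau>'. \<tau>' \<in> mixed_profiles G s t n) \<tau>"
proof -
  let ?P = "st_paths G s t" and ?D = "{..<k} \<rightarrow>\<^sub>E arcs G"
  have "finite ?P"
    using P(2) \<open>finite (arcs G)\<close> finite_subset by blast
  \<comment> \<open>Coordinates with \<open>i \<ge> n\<close> or outside the path set are pinned to
    0, so \<open>K\<close> is a product of simplices inside a full function space.\<close>
  define K where "K = (\<Pi>\<^sub>E (i, p) \<in> UNIV. if i < n \<and> p \<in> ?P then {0..1::real} else {0})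
    \<inter> (\<Inter>i<n. {f. (\<Sum>p\<in>?P. f (i, p)) = 1})"
  \<comment> \<open>\<open>h\<close> and \<open>\<Phi>\<close> are the hitting probability and
    worst-case cost as functions of the weights.\<close>
  define h :: "(nat \<times> 'b set \<Rightarrow> real) \<Rightarrow> 'b \<Rightarrow> real"
    where "h f e = 1 - (\<Prod>i<n. 1 - (\<Sum>p | p \<in> ?P \<and> e \<in> p. f (i, p)))" for f e
  define \<Phi> where "\<Phi> f = Max ((\<lambda>d. (\<Sum>e\<in>arcs G. h f e) + \<alpha> * (\<Sum>j<k. h f (d j))) ` ?D)" for f
  have cont_coord: "continuous_on S (\<lambda>f. f x)" for S :: "(nat \<times> 'b set \<Rightarrow> real) set" and x
    by (rule continuous_on_subset[OF continuous_on_product_coordinates]) simp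
  have "compact K"
    unfolding K_def
  proof (rule compact_Int_closed)
    \<comment> \<open>Tychonoff: the box is a product of compact intervals and singletons in the
      product topology.\<close>
    show "compact (\<Pi>\<^sub>E (i, p) \<in> UNIV. if i < n \<and> p \<in> ?P then {0..1::real} else {0})"
      by (subst compactin_euclidean_iff[symmetric], subst euclidean_product_topology[symmetric],
          subst compactin_PiE) auto
    show "closed (\<Inter>i<n. {f :: nat \<times> 'b set \<Rightarrow> real. (\<Sum>p\<in>?P. f (i, p)) = 1})"
      by (intro closed_INT ballI closed_Collect_eq continuous_on_sum cont_coord continuous_intros)
  qed
  \<comment> \<open>The profile in which every agent surely plays \<open>p0\<close> is a point of
    \<open>K\<close>.\<close>
  obtain p0 where "p0 \<in> ?P"
    using P(1) by blast
  have "(\<lambda>(i, p). of_bool (i < n \<and> p = p0)) \<in> K"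
    using \<open>p0 \<in> ?P\<close> \<open>finite ?P\<close> by (auto simp: K_def of_bool_def)
  then have "K \<noteq> {}"
    by blast
  have "continuous_on K (\<lambda>f. h f e)" for e
    unfolding h_def by (intro continuous_intros cont_coord)
  then have "continuous_on K \<Phi>"
    unfolding \<Phi>_def using \<open>finite (arcs G)\<close> \<open>arcs G \<noteq> {}\<close>
    by (intro continuous_on_Max continuous_intros finite_PiE) (auto simp: PiE_eq_empty_iff)
  then obtain f where "f \<in> K" and f_min: "\<And>g. g \<in> K \<Longrightarrow> \<Phi> f \<le> \<Phi> g"
    using continuous_attains_inf[OF \<open>compact K\<close> \<open>K \<noteq> {}\<close>] by blast
  have cost: "worst_case_cost G n k \<alpha> (product_strategy n \<sigma>) = \<Phi> g"
    if \<sigma>: "\<forall>i<n. set_pmf (\<sigma> i) \<subseteq> ?P" and g: "\<And>i p. i < n \<Longrightarrow> p \<in> ?P \<Longrightarrow> g (i, p) = pmf (\<sigma> i) p" for \<sigma> g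
  proof -
    have "hit_prob n \<sigma> e = h g e" for e
    proof -
      have "measure_pmf.prob (\<sigma> i) {p. e \<in> p} = (\<Sum>p | p \<in> ?P \<and> e \<in> p. g (i, p))" if "i < n" for i
      proof -
        have "measure_pmf.prob (\<sigma> i) {p. e \<in> p} = measure_pmf.prob (\<sigma> i) {p \<in> ?P. e \<in> p}"
          using \<sigma> that by (intro measure_pmf.finite_measure_eq_AE AE_pmfI) auto
        then show ?thesis
          using \<open>finite ?P\<close> g that by (simp add: measure_measure_pmf_finite)
      qed
      then show ?thesis
        by (simp add: hit_prob_def h_def)
    qed
    then show ?thesis
      using \<sigma> \<open>finite ?P\<close> P(2) \<open>finite (arcs G)\<close>
      by (simp add: worst_case_cost_def \<Phi>_def expectation_sum_cost[of n \<sigma> ?P]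
          expectation_card_union[of n \<sigma> ?P "arcs G"])
  qed
  \<comment> \<open>Indices \<open>i \<ge> n\<close> may carry any distribution, since
    \<open>product_strategy n\<close> looks only below \<open>n\<close>.\<close>
  have "\<exists>\<mu>. i < n \<longrightarrow> set_pmf \<mu> \<subseteq> ?P \<and> (\<forall>p. pmf \<mu> p = f (i, p))" for i
  proof (cases "i < n")
    case True
    have "f (i, p) \<in> (if p \<in> ?P then {0..1} else {0})" for p
      using PiE_mem[of f UNIV "\<lambda>(i, p). if i < n \<and> p \<in> ?P then {0..1} else {0}" "(i, p)"] \<open>f \<in> K\<close> True
      by (auto simp: K_def)
    moreover have "(\<Sum>p\<in>?P. f (i, p)) = 1"
      using \<open>f \<in> K\<close> True by (auto simp: K_def)
    ultimately show ?thesis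
      using pmf_with_weights[OF \<open>finite ?P\<close>, of "\<lambda>p. f (i, p)"]
      by (metis atLeastAtMost_iff order_refl singletonD)
  qed simp
  then obtain \<sigma> where \<sigma>: "\<And>i. i < n \<Longrightarrow> set_pmf (\<sigma> i) \<subseteq> ?P"
    "\<And>i p. i < n \<Longrightarrow> pmf (\<sigma> i) p = f (i, p)"
    by metis
  have "\<not> worst_case_cost G n k \<alpha> \<tau> < worst_case_cost G n k \<alpha> (product_strategy n \<sigma>)"
    if mixed: "\<tau> \<in> mixed_profiles G s t n" for \<tau>
  proof -
    obtain \<rho> where \<rho>: "\<tau> = product_strategy n \<rho>" "\<forall>i<n. set_pmf (\<rho> i) \<subseteq> ?P"
      using mixed by (auto simp: mixed_profiles_def)
    \<comment> \<open>Zero padding places the competing weights in \<open>K\<close>; by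
      \<open>cost\<close> only the entries with \<open>i < n\<close> and \<open>p\<close> a path
      matter.\<close>
    define g where "g = (\<lambda>(i, p). if i < n \<and> p \<in> ?P then pmf (\<rho> i) p else 0)"
    have "(\<Sum>p\<in>?P. pmf (\<rho> i) p) = 1" if "i < n" for i
      using \<rho>(2) that \<open>finite ?P\<close> by (intro sum_pmf_eq_1) auto
    then have "g \<in> K"
      by (auto simp: K_def g_def pmf_le_1)
    then show ?thesis
      using f_min[of g] cost[of \<sigma> f] cost[of \<rho> g] \<sigma> \<rho> by (simp add: g_def)
  qed
  moreover have "product_strategy n \<sigma> \<in> mixed_profiles G s t n"
    using \<sigma>(1) by (auto simp: mixed_profiles_def)
  ultimately show ?thesis
    unfolding is_arg_min_def by blast
qed

section \<open>Cuts and costs in an \<open>s\<close>-\<open>t\<close> graph\<close>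

context st_graph
begin

lemma st_paths_subset: "st_paths G s t \<subseteq> Pow (arcs G)"
  by (auto simp: st_paths_def apath_def awalk_def)

lemma finite_st_paths: "finite (st_paths G s t)"
  using st_paths_subset by (rule finite_subset) simp

lemma st_paths_nonempty: "st_paths G s t \<noteq> {}"
  using arcs_nonempty arc_on_st_path by (auto simp: st_paths_def)

section \<open>Cuts against families of edge-disjoint paths\<close>

lemma st_path_crosses_cut:
  assumes "p \<in> st_paths G s t" "s \<in> S" "t \<notin> S"
  shows "p \<inter> out_cut G S \<noteq> {}"
  using assms by (auto simp: st_paths_def elim: apath_crosses_cut)

lemma finite_out_cut: "finite (out_cut G S)"
  by (simp add: out_cut_def)

text \<open>Weak duality: pick a crossing arc on each path; disjointness makes the choice
  injective.\<close>

lemma card_edge_disjoint_paths_le: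
  assumes "edge_disjoint_paths G s t M" "s \<in> S" "t \<notin> S"
  shows "card M \<le> card (out_cut G S)"
proof -
  have "\<forall>p\<in>M. \<exists>e. e \<in> p \<inter> out_cut G S"
    using assms st_path_crosses_cut by (fastforce simp: edge_disjoint_paths_def)
  then obtain c where c: "\<And>p. p \<in> M \<Longrightarrow> c p \<in> p \<inter> out_cut G S"
    by metis
  have "inj_on c M"
  proof (rule inj_onI)
    fix p q assume "p \<in> M" "q \<in> M" "c p = c q"
    then have "p \<inter> q \<noteq> {}"
      using c[of p] c[of q] by auto
    then show "p = q"
      using assms(1) \<open>p \<in> M\<close> \<open>q \<in> M\<close> by (auto simp: edge_disjoint_paths_def disjoint_def)
  qed
  then show ?thesis
    using c finite_out_cut by (intro card_inj_on_le[of c]) auto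
qed

lemma finite_st_cuts: "finite (st_cuts G s t)"
proof -
  have "st_cuts G s t \<subseteq> Pow (arcs G)"
    by (auto simp: st_cuts_def out_cut_def)
  then show ?thesis
    by (rule finite_subset) simp
qed

lemma min_cut_size_le:
  assumes "S \<subseteq> verts G" "s \<in> S" "t \<notin> S"
  shows "min_cut_size G s t \<le> card (out_cut G S)"
  unfolding min_cut_size_def using assms finite_st_cuts by (auto simp: st_cuts_def intro!: Min_le)

lemma ex_min_cut:
  obtains S where "S \<subseteq> verts G" "s \<in> S" "t \<notin> S" "card (out_cut G S) = min_cut_size G s t"
proof -
  \<comment> \<open>The cut around \<open>s\<close> alone shows that the minimum ranges over a
    nonempty set.\<close>
  have "out_cut G {s} \<in> st_cuts G s t"
    unfolding st_cuts_def using source_in_verts source_neq_sink by blast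
  then have "min_cut_size G s t \<in> card ` st_cuts G s t"
    unfolding min_cut_size_def using finite_st_cuts by (intro Min_in) auto
  then show thesis
    using that by (auto simp: st_cuts_def)
qed

lemma min_cut_size_pos: "min_cut_size G s t \<ge> 1"
proof -
  obtain S where "s \<in> S" "t \<notin> S" "card (out_cut G S) = min_cut_size G s t"
    by (rule ex_min_cut)
  moreover have "out_cut G S \<noteq> {}"
    using st_paths_nonempty st_path_crosses_cut \<open>s \<in> S\<close> \<open>t \<notin> S\<close> by blast
  ultimately show ?thesis
    using finite_out_cut by (metis One_nat_def Suc_leI card_gt_0_iff)
qed

text \<open>A decomposed maximum flow has at least as many paths as a minimum cut has arcs. Weak
  duality gives equality, and it also bounds every larger disjoint family, so this one is
  inclusion-maximal.\<close>

theorem menger: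
  "\<exists>M \<in> maximal_flows G s t. card M = min_cut_size G s t"
proof -
  obtain m F S where "is_unit_flow G s t (int m) F" "S \<subseteq> verts G" "s \<in> S" "t \<notin> S" "m = card (out_cut G S)"
    using ex_flow_eq_cut[OF source_in_verts sink_in_verts source_neq_sink] by blast
  then obtain M where M: "edge_disjoint_paths G s t M" "card M \<ge> min_cut_size G s t"
    using flow_decomposition[OF _ source_in_verts source_neq_sink] min_cut_size_le by metis
  have le: "card M' \<le> min_cut_size G s t" if "edge_disjoint_paths G s t M'" for M'
    using that card_edge_disjoint_paths_le ex_min_cut by metis
  have "M' = M" if "edge_disjoint_paths G s t M'" "M \<subseteq> M'" for M'
  proof -
    have "finite M'"
      using that(1) finite_st_paths finite_subset by (auto simp: edge_disjoint_paths_def)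
    then show ?thesis
      using le[OF that(1)] M(2) that(2) by (metis card_seteq le_trans)
  qed
  then have "M \<in> maximal_flows G s t"
    using M(1) by (simp add: maximal_flows_def)
  then show ?thesis
    using le[OF M(1)] M(2) by (intro bexI[of _ M]) auto
qed

lemma finite_uniform_profiles: "finite (uniform_profiles G s t ord n)"
proof -
  have "maximal_flows G s t \<subseteq> Pow (st_paths G s t)"
    by (auto simp: maximal_flows_def edge_disjoint_paths_def)
  then have "finite (maximal_flows G s t)"
    using finite_st_paths by (meson finite_Pow_iff finite_subset)
  then show ?thesis
    unfolding uniform_profiles_def by (rule finite_bounded_index_family)
qed

section \<open>Lower and upper bounds on the worst-case cost\<close>

lemma worst_case_cost_ge:
  assumes "e \<in> arcs G"
  shows "measure_pmf.expectation \<sigma> (\<lambda>a. sum_cost n k a (\<lambda>j\<in>{..<k}. e) \<alpha>) \<le> worst_case_cost G n k \<alpha> \<sigma>"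
  \<comment> \<open>All interceptors watch \<open>e\<close>; restricting the constant function to
    \<open>{..<k}\<close> makes it an admissible placement.\<close>
  unfolding worst_case_cost_def using assms by (intro Max_ge finite_imageI finite_PiE) auto

lemma worst_case_cost_mixed_ge:
  assumes "\<tau> \<in> mixed_profiles G s t n" "n \<ge> 1" "\<alpha> \<ge> 0"
  shows "real (min_path_length G s t)
      + \<alpha> * real k * (1 - (1 - 1 / real (min_cut_size G s t)) ^ n) \<le> worst_case_cost G n k \<alpha> \<tau>"
proof -
  obtain \<sigma> where \<tau>: "\<tau> = product_strategy n \<sigma>" and \<sigma>: "\<forall>i<n. set_pmf (\<sigma> i) \<subseteq> st_paths G s t"
    using assms(1) by (auto simp: mixed_profiles_def)
  obtain S where S: "s \<in> S" "t \<notin> S" "card (out_cut G S) = min_cut_size G s t"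
    by (rule ex_min_cut)
  have "out_cut G S \<noteq> {}"
    using S(3) min_cut_size_pos by auto
  then obtain e where e: "e \<in> out_cut G S"
    "hit_prob n \<sigma> e \<ge> 1 - (1 - 1 / real (min_cut_size G s t)) ^ n"
    using ex_hit_prob_ge[OF finite_out_cut _ assms(2) \<sigma>, of S] st_path_crosses_cut S by auto
  have "real (min_path_length G s t)
      \<le> measure_pmf.expectation \<tau> (\<lambda>a. real (card (\<Union>i<n. a i)))"
  proof (rule measure_pmf.integral_ge_const)
    show "integrable \<tau> (\<lambda>a. real (card (\<Union>i<n. a i)))"
      unfolding \<tau> using finite_set_product_strategy[OF \<sigma> finite_st_paths]
      by (rule integrable_measure_pmf_finite)
    show "AE a in \<tau>. real (min_path_length G s t) \<le> real (card (\<Union>i<n. a i))"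
    proof (rule AE_pmfI)
      fix a assume "a \<in> set_pmf \<tau>"
      then have a: "\<And>i. i < n \<Longrightarrow> a i \<in> st_paths G s t"
        using \<tau> set_product_strategy[OF \<sigma>] by auto
      \<comment> \<open>Agent 0 exists because \<open>n \<ge> 1\<close>, and its path alone already
        has the minimum length.\<close>
      have "min_path_length G s t \<le> card (a 0)"
        unfolding min_path_length_def using a[of 0] \<open>n \<ge> 1\<close> finite_st_paths by (intro Min_le) auto
      also have "\<dots> \<le> card (\<Union>i<n. a i)"
      proof (rule card_mono)
        have "(\<Union>i<n. a i) \<subseteq> arcs G"
          using a st_paths_subset by blast
        then show "finite (\<Union>i<n. a i)"
          by (rule finite_subset) simp
      qed (use \<open>n \<ge> 1\<close> in \<open>force simp: Suc_le_eq\<close>)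
      finally show "real (min_path_length G s t) \<le> real (card (\<Union>i<n. a i))"
        by simp
    qed
  qed
  moreover have "\<alpha> * real k * (1 - (1 - 1 / real (min_cut_size G s t)) ^ n)
      \<le> \<alpha> * (\<Sum>j<k. hit_prob n \<sigma> ((\<lambda>j\<in>{..<k}. e) j))"
    using e(2) \<open>\<alpha> \<ge> 0\<close> by (simp add: mult.assoc mult_left_mono)
  moreover have "e \<in> arcs G"
    using e(1) by (simp add: out_cut_def)
  ultimately show ?thesis
    using worst_case_cost_ge[of e \<tau> n k \<alpha>] expectation_sum_cost[OF \<sigma> finite_st_paths]
    by (simp add: \<tau>)
qed

lemma worst_case_cost_uniform_le:
  assumes "edge_disjoint_paths G s t M" "M \<noteq> {}" "\<alpha> \<ge> 0"
  shows "worst_case_cost G n k \<alpha> (product_strategy n (\<lambda>_. pmf_of_set M))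
    \<le> real n * real (max_path_length G s t) + \<alpha> * real k * (1 - (1 - 1 / real (card M)) ^ n)"
proof -
  let ?\<sigma> = "\<lambda>_ :: nat. pmf_of_set M"
  have M: "M \<subseteq> st_paths G s t" "disjoint M"
    using assms(1) by (auto simp: edge_disjoint_paths_def)
  then have "finite M"
    using finite_st_paths finite_subset by blast
  then have \<sigma>: "\<forall>i<n. set_pmf (?\<sigma> i) \<subseteq> st_paths G s t"
    using M(1) \<open>M \<noteq> {}\<close> by simp
  have "measure_pmf.expectation (product_strategy n ?\<sigma>) (\<lambda>a. real (card (\<Union>i<n. a i)))
      \<le> real n * real (max_path_length G s t)"
  proof (rule measure_pmf.integral_le_const)
    show "integrable (product_strategy n ?\<sigma>) (\<lambda>a. real (card (\<Union>i<n. a i)))"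
      using finite_set_product_strategy[OF \<sigma> finite_st_paths]
      by (rule integrable_measure_pmf_finite)
    show "AE a in product_strategy n ?\<sigma>.
        real (card (\<Union>i<n. a i)) \<le> real n * real (max_path_length G s t)"
    proof (rule AE_pmfI)
      fix a assume "a \<in> set_pmf (product_strategy n ?\<sigma>)"
      then have a: "a i \<in> st_paths G s t" if "i < n" for i
        using set_product_strategy[OF \<sigma>] that by blast
      have "card (\<Union>i<n. a i) \<le> (\<Sum>i<n. card (a i))"
        by (rule card_UN_le) simp
      also have "\<dots> \<le> (\<Sum>i<n. max_path_length G s t)"
        unfolding max_path_length_def using a finite_st_paths by (intro sum_mono Max_ge) auto
      finally show "real (card (\<Union>i<n. a i)) \<le> real n * real (max_path_length G s t)"
        by (metis card_lessThan of_nat_le_iff of_nat_mult sum_constant of_nat_id)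
    qed
  qed
  \<comment> \<open>The bound is uniform in \<open>d\<close>, so it passes to the maximum over
    placements.\<close>
  moreover have "\<alpha> * (\<Sum>j<k. hit_prob n ?\<sigma> (d j)) \<le> \<alpha> * real k * (1 - (1 - 1 / real (card M)) ^ n)" for d
  proof -
    have "(\<Sum>j<k. hit_prob n ?\<sigma> (d j)) \<le> (\<Sum>j<k. 1 - (1 - 1 / real (card M)) ^ n)"
      using hit_prob_uniform_le[OF \<open>finite M\<close> \<open>M \<noteq> {}\<close> M(2)] by (intro sum_mono) auto
    then show ?thesis
      using \<open>\<alpha> \<ge> 0\<close> by (simp add: mult.assoc mult_left_mono)
  qed
  ultimately have "measure_pmf.expectation (product_strategy n ?\<sigma>) (\<lambda>a. sum_cost n k a d \<alpha>)
      \<le> real n * real (max_path_length G s t) + \<alpha> * real k * (1 - (1 - 1 / real (card M)) ^ n)" for d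
    unfolding expectation_sum_cost[OF \<sigma> finite_st_paths] by (intro add_mono)
  then show ?thesis
    unfolding worst_case_cost_def using arcs_nonempty
    by (intro Max.boundedI finite_imageI finite_PiE) (auto simp: PiE_eq_empty_iff)
qed

end

section \<open>Comparison of the two minima\<close>

theorem theorem5:
  fixes G :: "('a, 'b) pre_digraph" and s t :: 'a
    and ord :: "'b set set \<Rightarrow> 'b set list"
    and n k :: nat and \<epsilon> \<alpha> :: real
  assumes "st_graph G s t"
    and "length_ordering G s t ord"
    and "n \<ge> 1" and "k \<ge> 1"
    and "\<epsilon> > 0" and "\<alpha> > 0"
    and "\<alpha> \<ge> real (min_cut_size G s t)
              / (real k * \<epsilon> * expected_distinct (min_cut_size G s t) n)
            * (real n * real (max_path_length G s t)
                 - (1 + \<epsilon>) * real (min_path_length G s t))"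
  shows "\<exists>\<sigma> \<tau>.
      is_arg_min (worst_case_cost G n k \<alpha>) (\<lambda>\<sigma>'. \<sigma>' \<in> uniform_profiles G s t ord n) \<sigma> \<and>
      is_arg_min (worst_case_cost G n k \<alpha>) (\<lambda>\<tau>'. \<tau>' \<in> mixed_profiles G s t n) \<tau> \<and>
      worst_case_cost G n k \<alpha> \<sigma> \<le> (1 + \<epsilon>) * worst_case_cost G n k \<alpha> \<tau>"
proof -
  interpret st_graph G s t
    by fact
  let ?F = "worst_case_cost G n k \<alpha>"
  define m where "m = min_cut_size G s t"
  define q where "q = 1 - (1 - 1 / real m) ^ n"
  obtain M where M: "M \<in> maximal_flows G s t" "card M = m"
    using menger by (auto simp: m_def)
  have "m \<ge> 1"
    using min_cut_size_pos by (simp add: m_def)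
  \<comment> \<open>Comparing with the exponent 1 gives \<open>q \<ge> 1 / m\<close>, hence
    positivity.\<close>
  then have "(1 - 1 / real m) ^ n \<le> (1 - 1 / real m) ^ 1"
    using \<open>n \<ge> 1\<close> by (intro power_decreasing) auto
  also have "\<dots> < 1"
    using \<open>m \<ge> 1\<close> by simp
  finally have "q > 0"
    by (simp add: q_def)
  define U where "U = product_strategy n (\<lambda>_. pmf_of_set M)"
  have "edge_disjoint_paths G s t M" "M \<noteq> {}"
    using M \<open>m \<ge> 1\<close> by (auto simp: maximal_flows_def)
  have ord: "set (ord M) = M"
    using assms(2) M(1) by (auto simp: length_ordering_def)
  \<comment> \<open>The whole family is its own longest prefix, however \<open>ord\<close> breaks
    ties.\<close>
  then have "U \<in> uniform_profiles G s t ord n"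
    using M(1) \<open>M \<noteq> {}\<close> unfolding uniform_profiles_def U_def
    by (intro CollectI exI[of _ M] exI[of _ "length (ord M)"]) (auto simp: Suc_le_eq)
  then obtain \<sigma> where \<sigma>: "is_arg_min ?F (\<lambda>\<sigma>'. \<sigma>' \<in> uniform_profiles G s t ord n) \<sigma>" "?F \<sigma> \<le> ?F U"
    using ex_is_arg_min_if_finite[OF finite_uniform_profiles, of ord n ?F]
    by (auto simp: is_arg_min_def not_less)
  obtain \<tau> where \<tau>: "is_arg_min ?F (\<lambda>\<tau>'. \<tau>' \<in> mixed_profiles G s t n) \<tau>"
    using ex_arg_min_mixed[OF st_paths_nonempty st_paths_subset finite_arcs arcs_nonempty] by blast
  \<comment> \<open>\<open>expected_distinct m n\<close> equals \<open>m * q\<close>, so the factor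
    \<open>m\<close> cancels.\<close>
  have "real m / (real k * \<epsilon> * expected_distinct m n) = 1 / (real k * \<epsilon> * q)"
    using \<open>m \<ge> 1\<close> by (simp add: expected_distinct_def q_def)
  then have "real n * real (max_path_length G s t) - (1 + \<epsilon>) * real (min_path_length G s t)
      \<le> \<alpha> * (real k * \<epsilon> * q)"
    using assms(4,5,7) \<open>q > 0\<close> by (simp add: m_def pos_divide_le_eq)
  \<comment> \<open>Adding \<open>(1 + \<epsilon>)\<close> times the minimum length and
    \<open>\<alpha> * k * q\<close> to both sides produces the factor \<open>1 + \<epsilon>\<close>
    on the lower bound.\<close>
  then have "real n * real (max_path_length G s t) + \<alpha> * real k * q
      \<le> (1 + \<epsilon>) * (real (min_path_length G s t) + \<alpha> * real k * q)"
    by (simp add: algebra_simps)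
  also have "\<dots> \<le> (1 + \<epsilon>) * ?F \<tau>"
    using worst_case_cost_mixed_ge[of \<tau> n \<alpha> k] \<tau> assms(3,5,6)
    by (intro mult_left_mono) (auto simp: is_arg_min_def q_def m_def)
  finally have "?F \<sigma> \<le> (1 + \<epsilon>) * ?F \<tau>"
    using worst_case_cost_uniform_le[OF \<open>edge_disjoint_paths G s t M\<close> \<open>M \<noteq> {}\<close>, of \<alpha> n k] \<sigma>(2)
      M(2) \<open>\<alpha> > 0\<close> by (simp add: U_def q_def)
  then show ?thesis
    using \<sigma>(1) \<tau> by blast
qed

end
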